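(* Let $L$ be a finite semidistrim lattice. Then the maps $\mathcal{D}_L: L\to\mathrm{Ind}(G_L)$ and $\mathcal{U}_L: L\to\mathrm{Ind}(G_L)$ are bijections, where $\mathrm{Ind}(G_L)$ is the set of independent sets of the Galois graph $G_L$.
   Context: All lattices are finite. For a lattice $L$, $\mathcal{J}_L$ (resp. $\mathcal{M}_L$) is the set of join-irreducible (resp. meet-irreducible) elements; for $j\in\mathcal{J}_L$, $j_*$ is the unique element covered by $j$, and for $m\in\mathcal{M}_L$, $m^*$ is the unique element covering $m$. Let $\mathcal{M}_L(j)=\max\{z\in L: j_*=j\wedge z\}$ and $\mathcal{J}_L(m)=\min\{z\in L: m^*=m\vee z\}$. A pairing on $L$ is a bijection $\kappa:\mathcal{J}_L\to\mathcal{M}_L$ with $\kappa(j)\in\mathcal{M}_L(j)$ for all $j$ and $\kappa^{-1}(m)\in\mathcal{J}_L(m)$ for all $m$; $L$ is uniquely paired if it has exactly one pairing, denoted $\kappa_L$. A prime pair is a pair $(j_0,m_0)$ with $L=[\hat0,m_0]\sqcup[j_0,\hat1]$. A uniquely paired lattice $L$ is compatibly dismantlable if $|L|=1$ or there is a prime pair $(j_0,m_0)$ such that: (i) $[j_0,\hat1]$ is compatibly dismantlable and $\alpha(j)=j_0\vee j$ defines a bijection $\{j\in\mathcal{J}_L: j_0\le\kappa_L(j)\}\to\mathcal{J}_{[j_0,\hat1]}$ with $\kappa_{[j_0,\hat1]}(\alpha(j))=\kappa_L(j)$; (ii) $[\hat0,m_0]$ is compatibly dismantlable and $\beta(m)=m_0\wedge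 m$ defines a bijection $\{m\in\mathcal{M}_L:\kappa_L^{-1}(m)\le m_0\}\to\mathcal{M}_{[\hat0,m_0]}$ with $\kappa_{[\hat0,m_0]}^{-1}(\beta(m))=\kappa_L^{-1}(m)$. The Galois graph $G_L$ is the directed graph on $\mathcal{J}_L$ with an edge $j\to j'$ iff $j\ne j'$ and $j\not\le\kappa_L(j')$; an independent set is a set of vertices no two of which are joined by an edge. For $x\in L$ let $J_L(x)=\{j\in\mathcal{J}_L:j\le x\}$ and $M_L(x)=\{j\in\mathcal{J}_L:\kappa_L(j)\ge x\}$. For a compatibly dismantlable $L$, for every cover $x\lessdot y$ the set $M_L(x)\cap J_L(y)$ has exactly one element $j_{xy}$; set $\mathcal{D}_L(x)=\{j_{yx}:y\lessdot x\}$ and $\mathcal{U}_L(x)=\{j_{xy}:x\lessdot y\}$. $L$ is semidistrim if it is compatibly dismantlable and $\mathcal{D}_L(x),\mathcal{U}_L(x)\in\mathrm{Ind}(G_L)$ for all $x\in L$. *)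

theory Defs
  imports Main "HOL-Library.FuncSet" "Graph_Theory.Pair_Digraph"
begin

text \<open>
  A finite lattice is represented by its carrier: a nonempty finite subset \<open>L\<close> of a type of class
  \<open>lattice\<close> that is closed under the ambient meet and join. Then the order, meets and joins of \<open>L\<close>
  are the ambient ones, every finite lattice occurs (\<open>L = UNIV\<close> is allowed), and the intervals
  of \<open>L\<close>, over which the recursion below runs, are again lattices in this sense.
\<close>

definition finite_lattice_on :: "'a::lattice set \<Rightarrow> bool" where
  "finite_lattice_on L \<longleftrightarrow>
     finite L \<and> L \<noteq> {} \<and> (\<forall>x\<in>L. \<forall>y\<in>L. inf x y \<in> L \<and> sup x y \<in> L)"

lemma finite_lattice_on_UNIV: "finite_lattice_on (UNIV :: 'a::{finite,lattice} set)"
  by (simp add: finite_lattice_on_def)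

definition interval :: "'a::lattice set \<Rightarrow> 'a \<Rightarrow> 'a \<Rightarrow> 'a set" where
  "interval L a b = L \<inter> {a..b}"

lemma finite_lattice_on_interval:
  assumes "finite_lattice_on L" "a \<in> L" "b \<in> L" "a \<le> b"
  shows "finite_lattice_on (interval L a b)"
  using assms by (auto simp: finite_lattice_on_def interval_def intro: le_infI1 le_supI1)

abbreviation bottom :: "'a::lattice set \<Rightarrow> 'a" where
  "bottom L \<equiv> Inf_fin L"

abbreviation top_elem :: "'a::lattice set \<Rightarrow> 'a" where
  "top_elem L \<equiv> Sup_fin L"

lemma bottom_least:
  assumes "finite_lattice_on L"
  shows "bottom L \<in> L" and "x \<in> L \<Longrightarrow> bottom L \<le> x"
proof -
  from assms have *: "finite L" "L \<noteq> {}" "\<And>x y. x \<in> L \<Longrightarrow> y \<in> L \<Longrightarrow> inf x y \<in> L"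
    by (auto simp: finite_lattice_on_def)
  have "finite A \<Longrightarrow> A \<noteq> {} \<Longrightarrow> A \<subseteq> L \<Longrightarrow> Inf_fin A \<in> L" for A
    by (induction A rule: finite_ne_induct) (auto intro: *(3))
  with * show "bottom L \<in> L" by blast
  show "bottom L \<le> x" if "x \<in> L" using * that by (simp add: Inf_fin.coboundedI)
qed

lemma top_elem_greatest:
  assumes "finite_lattice_on L"
  shows "top_elem L \<in> L" and "x \<in> L \<Longrightarrow> x \<le> top_elem L"
proof -
  from assms have *: "finite L" "L \<noteq> {}" "\<And>x y. x \<in> L \<Longrightarrow> y \<in> L \<Longrightarrow> sup x y \<in> L"
    by (auto simp: finite_lattice_on_def)
  have "finite A \<Longrightarrow> A \<noteq> {} \<Longrightarrow> A \<subseteq> L \<Longrightarrow> Sup_fin A \<in> L" for A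
    by (induction A rule: finite_ne_induct) (auto intro: *(3))
  with * show "top_elem L \<in> L" by blast
  show "x \<le> top_elem L" if "x \<in> L" using * that by (simp add: Sup_fin.coboundedI)
qed

definition covered_in :: "'a::lattice set \<Rightarrow> 'a \<Rightarrow> 'a \<Rightarrow> bool" where
  "covered_in L x y \<longleftrightarrow> x \<in> L \<and> y \<in> L \<and> x < y \<and> \<not> (\<exists>z\<in>L. x < z \<and> z < y)"

definition join_irr :: "'a::lattice set \<Rightarrow> 'a set" where
  "join_irr L =
     {j \<in> L. j \<noteq> bottom L \<and> (\<forall>x\<in>L. \<forall>y\<in>L. j = sup x y \<longrightarrow> j = x \<or> j = y)}"

definition meet_irr :: "'a::lattice set \<Rightarrow> 'a set" where
  "meet_irr L =
     {m \<in> L. m \<noteq> top_elem L \<and> (\<forall>x\<in>L. \<forall>y\<in>L. m = inf x y \<longrightarrow> m = x \<or> m = y)}"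

definition lower_star :: "'a::lattice set \<Rightarrow> 'a \<Rightarrow> 'a" where
  "lower_star L j = (THE x. covered_in L x j)"

definition upper_star :: "'a::lattice set \<Rightarrow> 'a \<Rightarrow> 'a" where
  "upper_star L m = (THE y. covered_in L m y)"

lemma join_irr_unique_cover:
  assumes L: "finite_lattice_on L" and j: "j \<in> join_irr L"
  shows "\<exists>!x. covered_in L x j"
proof (rule ex_ex1I)
  let ?A = "{x \<in> L. x < j}"
  have "finite ?A" using L by (auto simp: finite_lattice_on_def)
  moreover have "bottom L \<in> ?A"
    using bottom_least[OF L] j by (auto simp: join_irr_def order.strict_iff_order)
  ultimately obtain x where "x \<in> ?A" "\<And>z. z \<in> ?A \<Longrightarrow> x \<le> z \<Longrightarrow> x = z"
    using finite_has_maximal2[of ?A "bottom L"] by blast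
  then show "\<exists>x. covered_in L x j"
    using j by (intro exI[of _ x]) (fastforce simp: covered_in_def join_irr_def less_le)
next
  fix x y assume xy: "covered_in L x j" "covered_in L y j"
  then have "sup x y \<in> L" "sup x y \<le> j"
    using L by (auto simp: covered_in_def finite_lattice_on_def)
  moreover have "sup x y \<noteq> j"
    proof
    assume "sup x y = j"
    then have "j = x \<or> j = y"
      using j xy by (fastforce simp only: join_irr_def covered_in_def mem_Collect_eq)
    then show False using xy by (auto simp: covered_in_def)
  qed
  ultimately have "\<not> x < sup x y" "\<not> y < sup x y"
    using xy by (auto simp: covered_in_def less_le)
  then show "x = y" by (metis order.not_eq_order_implies_strict sup.cobounded1 sup.cobounded2)
qed

lemma meet_irr_unique_cover:
  assumes L: "finite_lattice_on L" and m: "m \<in> meet_irr L"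
  shows "\<exists>!y. covered_in L m y"
proof (rule ex_ex1I)
  let ?A = "{x \<in> L. m < x}"
  have "finite ?A" using L by (auto simp: finite_lattice_on_def)
  moreover have "top_elem L \<in> ?A"
    using top_elem_greatest[OF L] m by (auto simp: meet_irr_def order.strict_iff_order)
  ultimately obtain x where "x \<in> ?A" "\<And>z. z \<in> ?A \<Longrightarrow> z \<le> x \<Longrightarrow> x = z"
    using finite_has_minimal2[of ?A "top_elem L"] by blast
  then show "\<exists>x. covered_in L m x"
    using m by (intro exI[of _ x]) (fastforce simp: covered_in_def meet_irr_def less_le)
next
  fix x y assume xy: "covered_in L m x" "covered_in L m y"
  then have "inf x y \<in> L" "m \<le> inf x y"
    using L by (auto simp: covered_in_def finite_lattice_on_def)
  moreover have "inf x y \<noteq> m"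
    proof
    assume "inf x y = m"
    then have "m = x \<or> m = y"
      using m xy by (fastforce simp only: meet_irr_def covered_in_def mem_Collect_eq)
    then show False using xy by (auto simp: covered_in_def)
  qed
  ultimately have "\<not> inf x y < x" "\<not> inf x y < y"
    using xy by (auto simp: covered_in_def less_le)
  then show "x = y" by (metis order.not_eq_order_implies_strict inf.cobounded1 inf.cobounded2)
qed

text \<open>The maximum (minimum) of a set need not exist; as in the definition of a pairing, where a
  value is required to lie in it, \<open>max\<close> (\<open>min\<close>) denotes the set of maximal (minimal) elements.\<close>

definition max_elements :: "'a::order set \<Rightarrow> 'a set" where
  "max_elements A = {x \<in> A. \<not> (\<exists>z\<in>A. x < z)}"

definition min_elements :: "'a::order set \<Rightarrow> 'a set" where
  "min_elements A = {x \<in> A. \<not> (\<exists>z\<in>A. z < x)}"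

definition meet_candidates :: "'a::lattice set \<Rightarrow> 'a \<Rightarrow> 'a set" where
  "meet_candidates L j = max_elements {z \<in> L. lower_star L j = inf j z}"

definition join_candidates :: "'a::lattice set \<Rightarrow> 'a \<Rightarrow> 'a set" where
  "join_candidates L m = min_elements {z \<in> L. upper_star L m = sup m z}"

text \<open>Pairings are extensional functions, so that uniqueness concerns only their values
  on the join-irreducible elements.\<close>

definition pairing :: "'a::lattice set \<Rightarrow> ('a \<Rightarrow> 'a) \<Rightarrow> bool" where
  "pairing L \<kappa> \<longleftrightarrow>
     \<kappa> \<in> extensional (join_irr L) \<and>
     bij_betw \<kappa> (join_irr L) (meet_irr L) \<and>
     (\<forall>j\<in>join_irr L. \<kappa> j \<in> meet_candidates L j) \<and>
     (\<forall>m\<in>meet_irr L. inv_into (join_irr L) \<kappa> m \<in> join_candidates L m)"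

definition uniquely_paired :: "'a::lattice set \<Rightarrow> bool" where
  "uniquely_paired L \<longleftrightarrow> (\<exists>!\<kappa>. pairing L \<kappa>)"

definition kappa :: "'a::lattice set \<Rightarrow> 'a \<Rightarrow> 'a" where
  "kappa L = (THE \<kappa>. pairing L \<kappa>)"

definition kappa_inv :: "'a::lattice set \<Rightarrow> 'a \<Rightarrow> 'a" where
  "kappa_inv L = inv_into (join_irr L) (kappa L)"

definition prime_pair :: "'a::lattice set \<Rightarrow> 'a \<Rightarrow> 'a \<Rightarrow> bool" where
  "prime_pair L j\<^sub>0 m\<^sub>0 \<longleftrightarrow>
     j\<^sub>0 \<in> L \<and> m\<^sub>0 \<in> L \<and>
     L = interval L (bottom L) m\<^sub>0 \<union> interval L j\<^sub>0 (top_elem L) \<and>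
     interval L (bottom L) m\<^sub>0 \<inter> interval L j\<^sub>0 (top_elem L) = {}"

text \<open>Both intervals of a prime pair are nonempty, hence strictly smaller than \<open>L\<close>: the
  recursion on finite lattices is well-founded and the inductive predicate is its only solution.\<close>

inductive compatibly_dismantlable :: "'a::lattice set \<Rightarrow> bool" where
  singleton: "uniquely_paired L \<Longrightarrow> card L = 1 \<Longrightarrow> compatibly_dismantlable L"
| dismantle: "compatibly_dismantlable L"
  if "uniquely_paired L" and "prime_pair L j\<^sub>0 m\<^sub>0"
    and "compatibly_dismantlable (interval L j\<^sub>0 (top_elem L))"
    and "bij_betw (\<lambda>j. sup j\<^sub>0 j) {j \<in> join_irr L. j\<^sub>0 \<le> kappa L j}
           (join_irr (interval L j\<^sub>0 (top_elem L)))"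
    and "\<forall>j\<in>{j \<in> join_irr L. j\<^sub>0 \<le> kappa L j}.
           kappa (interval L j\<^sub>0 (top_elem L)) (sup j\<^sub>0 j) = kappa L j"
    and "compatibly_dismantlable (interval L (bottom L) m\<^sub>0)"
    and "bij_betw (\<lambda>m. inf m\<^sub>0 m) {m \<in> meet_irr L. kappa_inv L m \<le> m\<^sub>0}
           (meet_irr (interval L (bottom L) m\<^sub>0))"
    and "\<forall>m\<in>{m \<in> meet_irr L. kappa_inv L m \<le> m\<^sub>0}.
           kappa_inv (interval L (bottom L) m\<^sub>0) (inf m\<^sub>0 m) = kappa_inv L m"

definition galois_graph :: "'a::lattice set \<Rightarrow> 'a pair_pre_digraph" where
  "galois_graph L =
     \<lparr> pverts = join_irr L,
       parcs = {(j, j'). j \<in> join_irr L \<and> j' \<in> join_irr L \<and> j \<noteq> j' \<and> \<not> j \<le> kappa L j'} \<rparr>"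

definition independent_sets :: "'a pair_pre_digraph \<Rightarrow> 'a set set" where
  "independent_sets G =
     {I. I \<subseteq> pverts G \<and> (\<forall>u\<in>I. \<forall>v\<in>I. u \<noteq> v \<longrightarrow> (u, v) \<notin> parcs G)}"

definition J_set :: "'a::lattice set \<Rightarrow> 'a \<Rightarrow> 'a set" where
  "J_set L x = {j \<in> join_irr L. j \<le> x}"

definition M_set :: "'a::lattice set \<Rightarrow> 'a \<Rightarrow> 'a set" where
  "M_set L x = {j \<in> join_irr L. x \<le> kappa L j}"

text \<open>The label of a cover \<open>x < y\<close>; if \<open>L\<close> is compatibly dismantlable,
  \<open>M_set L x \<inter> J_set L y\<close> is a singleton.\<close>

definition edge_label :: "'a::lattice set \<Rightarrow> 'a \<Rightarrow> 'a \<Rightarrow> 'a" where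
  "edge_label L x y = (THE j. j \<in> M_set L x \<inter> J_set L y)"

definition down_labels :: "'a::lattice set \<Rightarrow> 'a \<Rightarrow> 'a set" where
  "down_labels L x = {edge_label L y x | y. covered_in L y x}"

definition up_labels :: "'a::lattice set \<Rightarrow> 'a \<Rightarrow> 'a set" where
  "up_labels L x = {edge_label L x y | y. covered_in L x y}"

definition semidistrim :: "'a::lattice set \<Rightarrow> bool" where
  "semidistrim L \<longleftrightarrow>
     compatibly_dismantlable L \<and>
     (\<forall>x\<in>L. down_labels L x \<in> independent_sets (galois_graph L) \<and>
             up_labels L x \<in> independent_sets (galois_graph L))"

end

theory Submission
  imports Defs
begin

text \<open>
  Split \<open>L\<close> along a prime pair \<open>(j\<^sub>0, m\<^sub>0)\<close>, so \<open>\<kappa>(j\<^sub>0) = m\<^sub>0\<close>. If \<open>j\<^sub>0 \<le> j\<close> and \<open>\<kappa>(j) \<le> m\<^sub>0\<close>, then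
  \<open>j = j\<^sub>0\<close>: otherwise \<open>j\<^sub>0 \<le> j\<^sub>* \<le> \<kappa>(j) \<le> m\<^sub>0\<close>. Hence every other vertex of the Galois graph lies in
  \<open>A = {j. j \<le> m\<^sub>0}\<close> or in \<open>B = {j. j\<^sub>0 \<le> \<kappa>(j)}\<close>; there is an edge from every element of \<open>B - A\<close> to
  every element of \<open>A - B\<close>, and the other non-neighbours of \<open>j\<^sub>0\<close> are \<open>A \<inter> B\<close>. Writing \<open>i(S)\<close> for the
  number of independent sets inside \<open>S\<close>, the total number is therefore
  \<open>i(A) + i(B) - i(A \<inter> B) + i(A \<inter> B)\<close>. As \<open>A\<close> and \<open>B\<close> induce the Galois graphs of the
  two intervals, induction gives \<open>|Ind(G)| = |L|\<close> for every compatibly dismantlable lattice.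
  The same induction shows that cover labels are unique. Then \<open>x\<close> is the join of its down labels,
  so the down labels determine \<open>x\<close>; dually for the up labels. Both maps are thus injections between
  finite sets of equal size.
\<close>

section \<open>Pairings\<close>

lemma pairing_kappa: "uniquely_paired L \<Longrightarrow> pairing L (kappa L)"
  unfolding uniquely_paired_def kappa_def by (drule theI')

lemma kappa_bij: "uniquely_paired L \<Longrightarrow> bij_betw (kappa L) (join_irr L) (meet_irr L)"
  using pairing_kappa by (auto simp: pairing_def)

lemma kappa_candidates:
  "uniquely_paired L \<Longrightarrow> j \<in> join_irr L \<Longrightarrow> kappa L j \<in> meet_candidates L j"
  using pairing_kappa by (auto simp: pairing_def)

lemma kappa_mem: "uniquely_paired L \<Longrightarrow> j \<in> join_irr L \<Longrightarrow> kappa L j \<in> L"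
  using kappa_candidates[of L j] by (auto simp: meet_candidates_def max_elements_def)

lemma kappa_inv_kappa:
  "uniquely_paired L \<Longrightarrow> j \<in> join_irr L \<Longrightarrow> kappa_inv L (kappa L j) = j"
  unfolding kappa_inv_def by (metis bij_betw_inv_into_left kappa_bij)

lemma inf_kappa:
  "uniquely_paired L \<Longrightarrow> j \<in> join_irr L \<Longrightarrow> inf j (kappa L j) = lower_star L j"
  using kappa_candidates[of L j] by (auto simp: meet_candidates_def max_elements_def)

section \<open>Covers and join-irreducible elements\<close>

lemma covered_lower_star:
  "finite_lattice_on L \<Longrightarrow> j \<in> join_irr L \<Longrightarrow> covered_in L (lower_star L j) j"
  unfolding lower_star_def by (rule theI') (rule join_irr_unique_cover)

lemma lower_cover_exists:
  assumes L: "finite_lattice_on L" and "x \<in> L" "y \<in> L" "x < y"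
  obtains z where "covered_in L z y" "x \<le> z"
proof -
  let ?A = "{z \<in> L. x \<le> z \<and> z < y}"
  have "finite ?A" "x \<in> ?A" using assms by (auto simp: finite_lattice_on_def)
  then obtain z where z: "z \<in> ?A" "\<And>w. w \<in> ?A \<Longrightarrow> z \<le> w \<Longrightarrow> z = w"
    using finite_has_maximal2[of ?A x] by blast
  have "covered_in L z y"
    unfolding covered_in_def
  proof (intro conjI notI)
    assume "\<exists>w\<in>L. z < w \<and> w < y"
    then obtain w where w: "w \<in> L" "z < w" "w < y" by blast
    with z(1) have "w \<in> ?A" by auto
    with z(2)[of w] w show False by (simp add: less_le)
  qed (use z(1) assms in auto)
  with z(1) show thesis by (intro that) auto
qed

lemma upper_cover_exists:
  assumes L: "finite_lattice_on L" and "x \<in> L" "y \<in> L" "x < y"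
  obtains z where "covered_in L x z" "z \<le> y"
proof -
  let ?A = "{z \<in> L. x < z \<and> z \<le> y}"
  have "finite ?A" "y \<in> ?A" using assms by (auto simp: finite_lattice_on_def)
  then obtain z where z: "z \<in> ?A" "\<And>w. w \<in> ?A \<Longrightarrow> w \<le> z \<Longrightarrow> z = w"
    using finite_has_minimal2[of ?A y] by blast
  have "covered_in L x z"
    unfolding covered_in_def
  proof (intro conjI notI)
    assume "\<exists>w\<in>L. x < w \<and> w < z"
    then obtain w where w: "w \<in> L" "x < w" "w < z" by blast
    with z(1) have "w \<in> ?A" by auto
    with z(2)[of w] w show False by (simp add: less_le)
  qed (use z(1) assms in auto)
  with z(1) show thesis by (intro that) auto
qed

text \<open>By finiteness \<open>x\<close> lies below some lower cover of \<open>j\<close>, and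
  \<open>lower_star L j\<close> is the only one.\<close>

lemma le_lower_star:
  assumes L: "finite_lattice_on L" and j: "j \<in> join_irr L" and x: "x \<in> L" "x < j"
  shows "x \<le> lower_star L j"
proof -
  have "j \<in> L" using j by (simp add: join_irr_def)
  then obtain z where z: "covered_in L z j" "x \<le> z"
    using lower_cover_exists[OF L x(1)] x(2) by blast
  have "z = lower_star L j"
    using join_irr_unique_cover[OF L j] z(1) covered_lower_star[OF L j] by blast
  with z show ?thesis by simp
qed

text \<open>Otherwise the meet of \<open>j\<close> and \<open>kappa L j\<close>, which is
  \<open>lower_star L j\<close>, would be \<open>j\<close> itself. Most contradictions below end
  here.\<close>

lemma not_le_kappa:
  assumes "finite_lattice_on L" "uniquely_paired L" "j \<in> join_irr L"
  shows "\<not> j \<le> kappa L j"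
proof
  assume "j \<le> kappa L j"
  then have "lower_star L j = j"
    using inf_kappa[OF assms(2,3)] by (simp add: inf_absorb1)
  with covered_lower_star[OF assms(1,3)] show False by (simp add: covered_in_def)
qed

section \<open>Intervals and prime pairs\<close>

lemma bottom_lower_interval:
  assumes L: "finite_lattice_on L" and m: "m \<in> L"
  shows "bottom (interval L (bottom L) m) = bottom L"
proof (rule antisym)
  have I: "finite_lattice_on (interval L (bottom L) m)"
    using L m bottom_least[OF L] by (intro finite_lattice_on_interval) auto
  have "bottom L \<in> interval L (bottom L) m"
    using bottom_least[OF L] m by (auto simp: interval_def)
  then show "bottom (interval L (bottom L) m) \<le> bottom L" by (rule bottom_least(2)[OF I])
  show "bottom L \<le> bottom (interval L (bottom L) m)"
    using bottom_least(1)[OF I] by (simp add: interval_def)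
qed

text \<open>A join lies below \<open>m\<close> iff both joinands do, so an element below
  \<open>m\<close> has the same join decompositions in the interval as in \<open>L\<close>.\<close>

lemma join_irr_lower_interval:
  assumes L: "finite_lattice_on L" and m: "m \<in> L"
  shows "join_irr (interval L (bottom L) m) = {j \<in> join_irr L. j \<le> m}"
proof -
  have "interval L (bottom L) m = {x \<in> L. x \<le> m}"
    using bottom_least[OF L] by (auto simp: interval_def)
  moreover have "x \<le> m \<and> y \<le> m" if "j = sup x y" "j \<le> m" for j x y using that by simp
  ultimately show ?thesis
    unfolding join_irr_def bottom_lower_interval[OF assms] by blast
qed

locale prime_split =
  fixes L :: "'a::lattice set" and j\<^sub>0 m\<^sub>0 :: 'a
  assumes lat: "finite_lattice_on L"
    and up: "uniquely_paired L"
    and pp: "prime_pair L j\<^sub>0 m\<^sub>0"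
begin

abbreviation "lo \<equiv> interval L (bottom L) m\<^sub>0"
abbreviation "hi \<equiv> interval L j\<^sub>0 (top_elem L)"

lemma j0_mem: "j\<^sub>0 \<in> L" and m0_mem: "m\<^sub>0 \<in> L"
  using pp by (auto simp: prime_pair_def)

lemma lo_eq: "lo = {x \<in> L. x \<le> m\<^sub>0}"
  using bottom_least[OF lat] by (auto simp: interval_def)

lemma hi_eq: "hi = {x \<in> L. j\<^sub>0 \<le> x}"
  using top_elem_greatest[OF lat] by (auto simp: interval_def)

lemma le_m0_iff: "x \<in> L \<Longrightarrow> x \<le> m\<^sub>0 \<longleftrightarrow> \<not> j\<^sub>0 \<le> x"
  using pp unfolding prime_pair_def lo_eq hi_eq
  by (metis (no_types, lifting) Int_iff Un_iff empty_iff mem_Collect_eq)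

lemma lattice_lo: "finite_lattice_on lo"
  using lat m0_mem bottom_least[OF lat] by (intro finite_lattice_on_interval) auto

lemma lattice_hi: "finite_lattice_on hi"
  using lat j0_mem top_elem_greatest[OF lat] by (intro finite_lattice_on_interval) auto

lemma finite_L: "finite L"
  using lat by (simp add: finite_lattice_on_def)

lemma card_split: "card L = card lo + card hi"
proof -
  have "L = lo \<union> hi" "lo \<inter> hi = {}" using pp by (auto simp: prime_pair_def)
  moreover have "finite lo" "finite hi" using finite_L by (auto simp: interval_def)
  ultimately show ?thesis by (metis card_Un_disjoint)
qed

lemma join_irr_mem: "j \<in> join_irr L \<Longrightarrow> j \<in> L"
  by (simp add: join_irr_def)

lemma j0_join_irr: "j\<^sub>0 \<in> join_irr L"
proof -
  have "bottom L \<in> L" "bottom L \<le> m\<^sub>0" using bottom_least[OF lat] m0_mem by auto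
  then have "j\<^sub>0 \<noteq> bottom L" using le_m0_iff by blast
  moreover have "j\<^sub>0 = x \<or> j\<^sub>0 = y" if "x \<in> L" "y \<in> L" "j\<^sub>0 = sup x y" for x y
  proof -
    \<comment> \<open>If both joinands were below \<open>m\<^sub>0\<close>, so would be
      \<open>j\<^sub>0\<close>; hence one of them is above \<open>j\<^sub>0\<close>, and being a
      joinand it equals \<open>j\<^sub>0\<close>.\<close>
    have "\<not> (x \<le> m\<^sub>0 \<and> y \<le> m\<^sub>0)" using that le_m0_iff[OF j0_mem] by auto
    then have "j\<^sub>0 \<le> x \<or> j\<^sub>0 \<le> y" using that le_m0_iff by blast
    with that show ?thesis by (metis antisym sup.cobounded1 sup.cobounded2)
  qed
  ultimately show ?thesis using j0_mem by (auto simp: join_irr_def)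
qed

lemma eq_j0:
  assumes j: "j \<in> join_irr L" and "\<not> j \<le> m\<^sub>0" "\<not> j\<^sub>0 \<le> kappa L j"
  shows "j = j\<^sub>0"
proof (rule ccontr)
  assume "j \<noteq> j\<^sub>0"
  moreover have "j\<^sub>0 \<le> j" using assms le_m0_iff join_irr_mem by blast
  ultimately have "j\<^sub>0 \<le> lower_star L j" using le_lower_star[OF lat j j0_mem] by auto
  then have "j\<^sub>0 \<le> kappa L j" using inf_kappa[OF up j] by (metis le_inf_iff)
  with assms show False by simp
qed

text \<open>Primality gives \<open>kappa L j\<^sub>0 \<le> m\<^sub>0\<close>. Since
  \<open>m\<^sub>0\<close> also meets \<open>j\<^sub>0\<close> in
  \<open>lower_star L j\<^sub>0\<close>, maximality of \<open>kappa L j\<^sub>0\<close> forces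
  equality.\<close>

lemma kappa_j0: "kappa L j\<^sub>0 = m\<^sub>0"
proof -
  have le: "kappa L j\<^sub>0 \<le> m\<^sub>0"
    using not_le_kappa[OF lat up j0_join_irr] le_m0_iff kappa_mem[OF up j0_join_irr] by blast
  have cov: "covered_in L (lower_star L j\<^sub>0) j\<^sub>0" by (rule covered_lower_star[OF lat j0_join_irr])
  have "inf j\<^sub>0 m\<^sub>0 \<in> L" using lat j0_mem m0_mem by (simp add: finite_lattice_on_def)
  moreover have "inf j\<^sub>0 m\<^sub>0 < j\<^sub>0"
    using le_m0_iff[OF j0_mem] by (metis inf.cobounded1 inf.cobounded2 order.order_iff_strict)
  ultimately have "inf j\<^sub>0 m\<^sub>0 \<le> lower_star L j\<^sub>0" by (rule le_lower_star[OF lat j0_join_irr])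
  moreover have "lower_star L j\<^sub>0 \<le> inf j\<^sub>0 m\<^sub>0"
    using cov le_m0_iff[of "lower_star L j\<^sub>0"] by (auto simp: covered_in_def)
  ultimately have "lower_star L j\<^sub>0 = inf j\<^sub>0 m\<^sub>0" by (rule antisym[rotated])
  with le kappa_candidates[OF up j0_join_irr] m0_mem show ?thesis
    unfolding meet_candidates_def max_elements_def by (auto simp: order.order_iff_strict)
qed

end

section \<open>Independent sets\<close>

lemma independent_sets_galois_graph:
  "independent_sets (galois_graph L) =
     {I. I \<subseteq> join_irr L \<and> (\<forall>u\<in>I. \<forall>v\<in>I. u \<noteq> v \<longrightarrow> u \<le> kappa L v)}"
  by (auto simp: independent_sets_def galois_graph_def)

lemma finite_independent_sets: "finite L \<Longrightarrow> finite (independent_sets (galois_graph L))"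
  by (rule finite_subset[of _ "Pow L"])
    (auto simp: independent_sets_galois_graph join_irr_def)

text \<open>One dismantling step without its recursive conditions. Unique pairing of the lower
  interval serves to turn the condition on \<open>kappa_inv lo\<close> into one on
  \<open>kappa lo\<close>.\<close>

locale compatible_split = prime_split +
  assumes up_lo: "uniquely_paired lo"
    and alpha: "bij_betw (\<lambda>j. sup j\<^sub>0 j) {j \<in> join_irr L. j\<^sub>0 \<le> kappa L j} (join_irr hi)"
    and kappa_alpha: "\<forall>j\<in>{j \<in> join_irr L. j\<^sub>0 \<le> kappa L j}. kappa hi (sup j\<^sub>0 j) = kappa L j"
    and beta: "bij_betw (\<lambda>m. inf m\<^sub>0 m) {m \<in> meet_irr L. kappa_inv L m \<le> m\<^sub>0} (meet_irr lo)"
    and kappa_inv_beta: "\<forall>m\<in>{m \<in> meet_irr L. kappa_inv L m \<le> m\<^sub>0}.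
           kappa_inv lo (inf m\<^sub>0 m) = kappa_inv L m"
begin

abbreviation "A \<equiv> {j \<in> join_irr L. j \<le> m\<^sub>0}"
abbreviation "B \<equiv> {j \<in> join_irr L. j\<^sub>0 \<le> kappa L j}"
abbreviation "Ind \<equiv> independent_sets (galois_graph L)"

lemma join_irr_lo: "join_irr lo = A"
  by (rule join_irr_lower_interval[OF lat m0_mem])

lemma kappa_lo:
  assumes "j \<in> A"
  shows "kappa lo j = inf m\<^sub>0 (kappa L j)"
proof -
  have j: "j \<in> join_irr L" "j \<le> m\<^sub>0" using assms by auto
  let ?m = "kappa L j"
  have "?m \<in> meet_irr L" using kappa_bij[OF up] j by (auto simp: bij_betw_def)
  then have m: "?m \<in> {m \<in> meet_irr L. kappa_inv L m \<le> m\<^sub>0}"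
    using kappa_inv_kappa[OF up j(1)] j by simp
  then have "inf m\<^sub>0 ?m \<in> meet_irr lo" using beta by (auto simp: bij_betw_def)
  \<comment> \<open>Compatibility only states a value of \<open>kappa_inv lo\<close>; surjectivity
    of \<open>kappa lo\<close> allows inverting it.\<close>
  then have "inf m\<^sub>0 ?m \<in> kappa lo ` join_irr lo" using kappa_bij[OF up_lo] by (auto simp: bij_betw_def)
  then have "kappa lo (kappa_inv lo (inf m\<^sub>0 ?m)) = inf m\<^sub>0 ?m"
    unfolding kappa_inv_def by (rule f_inv_into_f)
  then show ?thesis using kappa_inv_beta m kappa_inv_kappa[OF up j(1)] by simp
qed

lemma le_kappa_lo: "x \<le> m\<^sub>0 \<Longrightarrow> j \<in> A \<Longrightarrow> x \<le> kappa lo j \<longleftrightarrow> x \<le> kappa L j"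
  by (simp add: kappa_lo)

text \<open>For \<open>j'\<close> in \<open>B\<close> the value of kappa is unchanged and above
  \<open>j\<^sub>0\<close>, so joining with \<open>j\<^sub>0\<close> does not affect the comparison.
  Thus \<alpha> preserves and reflects non-edges.\<close>

lemma alpha_le_kappa_hi: "j' \<in> B \<Longrightarrow> sup j\<^sub>0 j \<le> kappa hi (sup j\<^sub>0 j') \<longleftrightarrow> j \<le> kappa L j'"
  using kappa_alpha by simp

lemma independent_lo: "independent_sets (galois_graph lo) = {I \<in> Ind. I \<subseteq> A}"
proof (intro set_eqI)
  fix I
  show "I \<in> independent_sets (galois_graph lo) \<longleftrightarrow> I \<in> {I \<in> Ind. I \<subseteq> A}"
  proof (cases "I \<subseteq> A")
    case True
    then have "u \<le> kappa lo v \<longleftrightarrow> u \<le> kappa L v" if "u \<in> I" "v \<in> I" for u v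
      using that le_kappa_lo by blast
    moreover have "I \<subseteq> join_irr L" using True by blast
    ultimately show ?thesis
      using True by (simp add: independent_sets_galois_graph join_irr_lo cong: ball_cong)
  qed (simp add: independent_sets_galois_graph join_irr_lo)
qed

text \<open>\<alpha> is an isomorphism from the subgraph induced on \<open>B\<close> to the Galois
  graph of \<open>hi\<close>, so taking images matches their independent sets.\<close>

lemma card_independent_hi: "card (independent_sets (galois_graph hi)) = card {I \<in> Ind. I \<subseteq> B}"
proof -
  let ?\<alpha> = "\<lambda>j. sup j\<^sub>0 j"
  have inj: "inj_on ?\<alpha> B" and img: "?\<alpha> ` B = join_irr hi" using alpha by (auto simp: bij_betw_def)
  have indep: "?\<alpha> ` I \<in> independent_sets (galois_graph hi) \<longleftrightarrow> I \<in> Ind" if "I \<subseteq> B" for I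
  proof -
    have "?\<alpha> u \<noteq> ?\<alpha> v \<longleftrightarrow> u \<noteq> v" if "u \<in> I" "v \<in> I" for u v
      using that \<open>I \<subseteq> B\<close> inj by (meson inj_onD subsetD)
    moreover have "?\<alpha> u \<le> kappa hi (?\<alpha> v) \<longleftrightarrow> u \<le> kappa L v" if "v \<in> I" for u v
      using that \<open>I \<subseteq> B\<close> alpha_le_kappa_hi by blast
    moreover have "?\<alpha> ` I \<subseteq> join_irr hi" "I \<subseteq> join_irr L" using \<open>I \<subseteq> B\<close> img by blast+
    ultimately show ?thesis
      by (simp add: independent_sets_galois_graph Ball_image_comp del: sup.bounded_iff cong: ball_cong)
  qed
  have "bij_betw ((`) ?\<alpha>) {I \<in> Ind. I \<subseteq> B} (independent_sets (galois_graph hi))"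
    unfolding bij_betw_def
  proof (intro conjI equalityI subsetI)
    show "inj_on ((`) ?\<alpha>) {I \<in> Ind. I \<subseteq> B}"
      using inj_on_image_Pow[OF inj] by (rule inj_on_subset) auto
  next
    fix K assume "K \<in> (`) ?\<alpha> ` {I \<in> Ind. I \<subseteq> B}"
    then show "K \<in> independent_sets (galois_graph hi)" using indep by blast
  next
    fix K assume K: "K \<in> independent_sets (galois_graph hi)"
    then have "K \<subseteq> ?\<alpha> ` B" unfolding img by (simp add: independent_sets_galois_graph)
    then obtain I where "I \<subseteq> B" "K = ?\<alpha> ` I" by (meson subset_imageE)
    with K indep show "K \<in> (`) ?\<alpha> ` {I \<in> Ind. I \<subseteq> B}" by blast
  qed
  then show ?thesis by (rule bij_betw_same_card[symmetric])
qed

lemma j0_notin: "j\<^sub>0 \<notin> A" "j\<^sub>0 \<notin> B"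
  using le_m0_iff[OF j0_mem] le_m0_iff[OF m0_mem] kappa_j0 by auto

text \<open>Absence of edges between \<open>j\<close> and \<open>j\<^sub>0\<close>, in the two
  directions, means \<open>j \<le> kappa L j\<^sub>0 = m\<^sub>0\<close> and
  \<open>j\<^sub>0 \<le> kappa L j\<close>, that is, \<open>j\<close> lies in \<open>A\<close> and
  in \<open>B\<close>.\<close>

lemma independent_j0: "{I \<in> Ind. j\<^sub>0 \<in> I} = insert j\<^sub>0 ` {I \<in> Ind. I \<subseteq> A \<inter> B}"
proof (intro equalityI subsetI)
  fix I assume I: "I \<in> {I \<in> Ind. j\<^sub>0 \<in> I}"
  then have "I - {j\<^sub>0} \<in> Ind" by (auto simp: independent_sets_galois_graph)
  moreover have "I - {j\<^sub>0} \<subseteq> A \<inter> B"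
    using I kappa_j0 by (fastforce simp: independent_sets_galois_graph)
  moreover have "I = insert j\<^sub>0 (I - {j\<^sub>0})" using I by auto
  ultimately show "I \<in> insert j\<^sub>0 ` {I \<in> Ind. I \<subseteq> A \<inter> B}" by blast
next
  fix I assume "I \<in> insert j\<^sub>0 ` {I \<in> Ind. I \<subseteq> A \<inter> B}"
  then show "I \<in> {I \<in> Ind. j\<^sub>0 \<in> I}"
    using kappa_j0 j0_join_irr by (auto simp: independent_sets_galois_graph)
qed

lemma independent_cases:
  assumes I: "I \<in> Ind" and "j\<^sub>0 \<notin> I"
  shows "I \<subseteq> A \<or> I \<subseteq> B"
proof (rule ccontr)
  assume "\<not> (I \<subseteq> A \<or> I \<subseteq> B)"
  then obtain a b where ab: "a \<in> I" "a \<notin> A" "b \<in> I" "b \<notin> B" by blast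
  have irr: "a \<in> join_irr L" "b \<in> join_irr L"
    using I ab by (auto simp: independent_sets_galois_graph)
  \<comment> \<open>A common vertex outside both \<open>A\<close> and \<open>B\<close> would be
    \<open>j\<^sub>0\<close>.\<close>
  have "b \<noteq> a" using ab irr eq_j0[of a] \<open>j\<^sub>0 \<notin> I\<close> by auto
  then have "a \<le> kappa L b" using I ab by (simp add: independent_sets_galois_graph)
  moreover have "j\<^sub>0 \<le> a" using ab irr le_m0_iff[OF join_irr_mem] by blast
  ultimately have "j\<^sub>0 \<le> kappa L b" by (rule order.trans[rotated])
  with ab irr show False by simp
qed

lemma card_independent:
  "card Ind = card (independent_sets (galois_graph lo)) + card (independent_sets (galois_graph hi))"
proof -
  let ?F = "\<lambda>S. {I \<in> Ind. I \<subseteq> S}"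
  have fin: "finite Ind" by (rule finite_independent_sets[OF finite_L])
  have "Ind = {I \<in> Ind. j\<^sub>0 \<in> I} \<union> (?F A \<union> ?F B)" using independent_cases by auto
  moreover have "{I \<in> Ind. j\<^sub>0 \<in> I} \<inter> (?F A \<union> ?F B) = {}" using j0_notin by blast
  ultimately have "card Ind = card {I \<in> Ind. j\<^sub>0 \<in> I} + card (?F A \<union> ?F B)"
    using fin by (metis (no_types, lifting) card_Un_disjoint finite_Un)
  \<comment> \<open>This count cancels the overlap that inclusion-exclusion subtracts for
    \<open>A\<close> and \<open>B\<close>.\<close>
  moreover have "card {I \<in> Ind. j\<^sub>0 \<in> I} = card (?F (A \<inter> B))"
    unfolding independent_j0
  proof (intro card_image inj_onI)
    fix I K assume "I \<in> ?F (A \<inter> B)" "K \<in> ?F (A \<inter> B)" and eq: "insert j\<^sub>0 I = insert j\<^sub>0 K"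
    then have "j\<^sub>0 \<notin> I" "j\<^sub>0 \<notin> K" using j0_notin by blast+
    with eq show "I = K" by (simp add: insert_ident)
  qed
  moreover have "?F A \<inter> ?F B = ?F (A \<inter> B)" by blast
  then have "card (?F A) + card (?F B) = card (?F A \<union> ?F B) + card (?F (A \<inter> B))"
    using card_Un_Int[of "?F A" "?F B"] fin by simp
  ultimately show ?thesis unfolding independent_lo card_independent_hi by simp
qed

section \<open>Cover labels\<close>

lemma label_lo:
  assumes "y \<le> m\<^sub>0" "x \<le> y"
  shows "M_set L x \<inter> J_set L y = M_set lo x \<inter> J_set lo y"
proof -
  have "x \<le> m\<^sub>0" using assms by simp
  then show ?thesis
    unfolding M_set_def J_set_def join_irr_lo using assms le_kappa_lo by auto
qed

text \<open>\<alpha> keeps the kappa values on \<open>B\<close>, and as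
  \<open>j\<^sub>0 \<le> y\<close>, an element is below \<open>y\<close> iff its join with
  \<open>j\<^sub>0\<close> is.\<close>

lemma label_hi:
  assumes "j\<^sub>0 \<le> x" "x \<le> y"
  shows "bij_betw (\<lambda>j. sup j\<^sub>0 j) (M_set L x \<inter> J_set L y) (M_set hi x \<inter> J_set hi y)"
proof -
  have y: "j\<^sub>0 \<le> y" using assms by simp
  have sub: "M_set L x \<inter> J_set L y \<subseteq> B" using assms by (auto simp: M_set_def J_set_def)
  have "M_set hi x \<inter> J_set hi y = {k \<in> (\<lambda>j. sup j\<^sub>0 j) ` B. x \<le> kappa hi k \<and> k \<le> y}"
    using alpha by (auto simp: bij_betw_def M_set_def J_set_def)
  also have "\<dots> = (\<lambda>j. sup j\<^sub>0 j) ` (M_set L x \<inter> J_set L y)"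
    using kappa_alpha y sub by (auto simp: M_set_def J_set_def)
  finally have "(\<lambda>j. sup j\<^sub>0 j) ` (M_set L x \<inter> J_set L y) = M_set hi x \<inter> J_set hi y" by simp
  with alpha sub show ?thesis by (rule bij_betw_subset)
qed

text \<open>Here \<open>y\<close> is the join of \<open>x\<close> and \<open>j\<^sub>0\<close>, and
  \<open>x\<close> the meet of \<open>y\<close> and \<open>m\<^sub>0\<close>. A label
  \<open>j\<close> below \<open>m\<^sub>0\<close> would satisfy
  \<open>j \<le> x \<le> kappa L j\<close>; if \<open>j\<^sub>0 \<le> kappa L j\<close>, then
  \<open>j \<le> y \<le> kappa L j\<close>. Both are impossible, which leaves
  \<open>j\<^sub>0\<close>.\<close>

lemma label_crossing:
  assumes cov: "covered_in L x y" and x: "x \<le> m\<^sub>0" and y: "\<not> y \<le> m\<^sub>0"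
  shows "M_set L x \<inter> J_set L y = {j\<^sub>0}"
proof -
  have xy: "x \<in> L" "y \<in> L" "x < y" using cov by (auto simp: covered_in_def)
  have j0y: "j\<^sub>0 \<le> y" using y le_m0_iff[OF xy(2)] by blast
  have j0x: "\<not> j\<^sub>0 \<le> x" using x le_m0_iff[OF xy(1)] by blast
  have between: "z = x \<or> z = y" if "z \<in> L" "x \<le> z" "z \<le> y" for z
    using cov that by (auto simp: covered_in_def order.order_iff_strict)
  have "sup x j\<^sub>0 \<in> L" "inf y m\<^sub>0 \<in> L"
    using lat xy j0_mem m0_mem by (auto simp: finite_lattice_on_def)
  then have "sup x j\<^sub>0 = x \<or> sup x j\<^sub>0 = y" "inf y m\<^sub>0 = x \<or> inf y m\<^sub>0 = y"
    using between[of "sup x j\<^sub>0"] between[of "inf y m\<^sub>0"] xy(3) x j0y by (simp_all add: less_imp_le)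
  moreover have "sup x j\<^sub>0 \<noteq> x" "inf y m\<^sub>0 \<noteq> y"
    using y j0x by (simp_all add: sup.absorb_iff1[symmetric] inf.absorb_iff1[symmetric])
  ultimately have sup: "sup x j\<^sub>0 = y" and inf: "inf y m\<^sub>0 = x" by blast+
  have "j = j\<^sub>0" if j: "j \<in> join_irr L" "x \<le> kappa L j" "j \<le> y" for j
  proof (rule eq_j0[OF j(1)])
    have nle: "\<not> j \<le> kappa L j" by (rule not_le_kappa[OF lat up j(1)])
    show "\<not> j \<le> m\<^sub>0" using nle j inf by (metis le_inf_iff order.trans)
    show "\<not> j\<^sub>0 \<le> kappa L j" using nle j sup by (metis le_sup_iff order.trans)
  qed
  moreover have "j\<^sub>0 \<in> M_set L x \<inter> J_set L y"
    using j0_join_irr kappa_j0 x j0y by (simp add: M_set_def J_set_def)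
  ultimately show ?thesis by (auto simp: M_set_def J_set_def)
qed

lemma card_label:
  assumes cov: "covered_in L x y"
    and lo: "\<And>x y. covered_in lo x y \<Longrightarrow> card (M_set lo x \<inter> J_set lo y) = 1"
    and hi: "\<And>x y. covered_in hi x y \<Longrightarrow> card (M_set hi x \<inter> J_set hi y) = 1"
  shows "card (M_set L x \<inter> J_set L y) = 1"
proof -
  have xy: "x \<in> L" "y \<in> L" "x \<le> y" using cov by (auto simp: covered_in_def)
  \<comment> \<open>A cover lies inside one of the two intervals or crosses from the lower to the
    upper one.\<close>
  consider "y \<le> m\<^sub>0" | "j\<^sub>0 \<le> x" | "x \<le> m\<^sub>0" "\<not> y \<le> m\<^sub>0" using le_m0_iff xy by blast
  then show ?thesis
  proof cases
    case 1
    then have "covered_in lo x y" using cov xy by (auto simp: covered_in_def lo_eq)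
    then show ?thesis using lo label_lo[OF 1 xy(3)] by simp
  next
    case 2
    then have "covered_in hi x y" using cov xy by (auto simp: covered_in_def hi_eq)
    then show ?thesis using hi bij_betw_same_card[OF label_hi[OF 2 xy(3)]] by simp
  next
    case 3
    then show ?thesis using label_crossing[OF cov] by simp
  qed
qed

end

section \<open>Compatibly dismantlable lattices\<close>

lemma uniquely_paired_if_compatibly_dismantlable:
  "compatibly_dismantlable L \<Longrightarrow> uniquely_paired L"
  by (induction rule: compatibly_dismantlable.induct) auto

lemma compatibly_dismantlable_facts:
  assumes "compatibly_dismantlable L" "finite_lattice_on L"
  shows "card (independent_sets (galois_graph L)) = card L \<and>
    (\<forall>x y. covered_in L x y \<longrightarrow> card (M_set L x \<inter> J_set L y) = 1)"
  using assms
proof (induction rule: compatibly_dismantlable.induct)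
  case (singleton L)
  then obtain a where a: "L = {a}" by (auto simp: card_1_singleton_iff)
  \<comment> \<open>The only element is the bottom, so the graph is empty and has just the empty
    independent set.\<close>
  then have "join_irr L = {}" by (auto simp: join_irr_def)
  then have "independent_sets (galois_graph L) = {{}}" by (auto simp: independent_sets_galois_graph)
  then show ?case using a by (auto simp: covered_in_def)
next
  case (dismantle L j\<^sub>0 m\<^sub>0)
  interpret compatible_split L j\<^sub>0 m\<^sub>0
    by unfold_locales
      (fact dismantle.hyps dismantle.prems
        uniquely_paired_if_compatibly_dismantlable[OF dismantle.hyps(6)])+
  have lo: "card (independent_sets (galois_graph lo)) = card lo"
      "\<And>x y. covered_in lo x y \<Longrightarrow> card (M_set lo x \<inter> J_set lo y) = 1"
    and hi: "card (independent_sets (galois_graph hi)) = card hi"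
      "\<And>x y. covered_in hi x y \<Longrightarrow> card (M_set hi x \<inter> J_set hi y) = 1"
    using dismantle.IH(1)[OF lattice_hi] dismantle.IH(2)[OF lattice_lo] by simp_all
  show ?case using card_independent card_split lo(1) hi(1) card_label[OF _ lo(2) hi(2)] by simp
qed

lemma edge_label_in:
  assumes "compatibly_dismantlable L" "finite_lattice_on L" "covered_in L x y"
  shows "edge_label L x y \<in> M_set L x \<inter> J_set L y"
proof -
  have "card (M_set L x \<inter> J_set L y) = 1" using compatibly_dismantlable_facts assms by blast
  then obtain j where "M_set L x \<inter> J_set L y = {j}" by (auto simp: card_1_singleton_iff)
  then show ?thesis unfolding edge_label_def by simp
qed

section \<open>Injectivity of the two label maps\<close>

text \<open>If \<open>x\<close> is not below \<open>y\<close>, some lower cover \<open>z\<close> of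
  \<open>x\<close> is above their meet. Its label \<open>j\<close> is also a down label of
  \<open>y\<close>, so \<open>j\<close> is below the meet, hence
  \<open>j \<le> z \<le> kappa L j\<close>, a contradiction.\<close>

lemma inj_on_down_labels:
  assumes cd: "compatibly_dismantlable L" and L: "finite_lattice_on L"
  shows "inj_on (down_labels L) L"
proof -
  have "x \<le> y" if xy: "x \<in> L" "y \<in> L" "down_labels L x = down_labels L y" for x y
  proof (rule ccontr)
    assume "\<not> x \<le> y"
    then have "inf x y < x" by (metis inf.cobounded1 inf.cobounded2 order.order_iff_strict)
    moreover have "inf x y \<in> L" using L xy by (simp add: finite_lattice_on_def)
    ultimately obtain z where z: "covered_in L z x" "inf x y \<le> z"
      using lower_cover_exists[OF L] xy(1) by blast
    let ?j = "edge_label L z x"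
    have j: "?j \<in> join_irr L" "z \<le> kappa L ?j" "?j \<le> x"
      using edge_label_in[OF cd L z(1)] by (auto simp: M_set_def J_set_def)
    have "?j \<in> down_labels L y" using z(1) xy(3) unfolding down_labels_def by blast
    then obtain w where "?j = edge_label L w y" "covered_in L w y"
      unfolding down_labels_def by blast
    then have "?j \<le> y" using edge_label_in[OF cd L] by (fastforce simp: J_set_def)
    then have "?j \<le> kappa L ?j" using j z(2) by (meson le_inf_iff order.trans)
    with not_le_kappa[OF L uniquely_paired_if_compatibly_dismantlable[OF cd] j(1)] show False ..
  qed
  then show ?thesis by (auto intro!: inj_onI antisym)
qed

text \<open>Dual argument: the shared label \<open>j\<close> of a cover of \<open>x\<close> by some
  \<open>z\<close> below the join has \<open>kappa L j\<close> above both \<open>x\<close> and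
  \<open>y\<close>, hence above \<open>z\<close> and \<open>j\<close>.\<close>

lemma inj_on_up_labels:
  assumes cd: "compatibly_dismantlable L" and L: "finite_lattice_on L"
  shows "inj_on (up_labels L) L"
proof -
  have "y \<le> x" if xy: "x \<in> L" "y \<in> L" "up_labels L x = up_labels L y" for x y
  proof (rule ccontr)
    assume "\<not> y \<le> x"
    then have "x < sup x y" by (metis sup.cobounded1 sup.cobounded2 order.order_iff_strict)
    moreover have "sup x y \<in> L" using L xy by (simp add: finite_lattice_on_def)
    ultimately obtain z where z: "covered_in L x z" "z \<le> sup x y"
      using upper_cover_exists[OF L] xy(1) by blast
    let ?j = "edge_label L x z"
    have j: "?j \<in> join_irr L" "x \<le> kappa L ?j" "?j \<le> z"
      using edge_label_in[OF cd L z(1)] by (auto simp: M_set_def J_set_def)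
    have "?j \<in> up_labels L y" using z(1) xy(3) unfolding up_labels_def by blast
    then obtain w where w: "?j = edge_label L y w" "covered_in L y w"
      unfolding up_labels_def by blast
    then have "y \<le> kappa L ?j" using edge_label_in[OF cd L w(2)] by (auto simp: M_set_def)
    then have "?j \<le> kappa L ?j" using j z(2) by (meson le_sup_iff order.trans)
    with not_le_kappa[OF L uniquely_paired_if_compatibly_dismantlable[OF cd] j(1)] show False ..
  qed
  then show ?thesis by (auto intro!: inj_onI antisym)
qed

theorem theorem6p4:
  fixes L :: "'a::lattice set"
  assumes "finite_lattice_on L"
    and "semidistrim L"
  shows "bij_betw (down_labels L) L (independent_sets (galois_graph L)) \<and>
         bij_betw (up_labels L) L (independent_sets (galois_graph L))"
proof -
  have cd: "compatibly_dismantlable L"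
    and maps: "down_labels L ` L \<subseteq> independent_sets (galois_graph L)"
      "up_labels L ` L \<subseteq> independent_sets (galois_graph L)"
    using assms(2) by (auto simp: semidistrim_def)
  have card: "card (independent_sets (galois_graph L)) = card L"
    using compatibly_dismantlable_facts[OF cd assms(1)] by blast
  have fin: "finite (independent_sets (galois_graph L))"
    using assms(1) by (intro finite_independent_sets) (simp add: finite_lattice_on_def)
  \<comment> \<open>The image has as many elements as the finite target, so it is all of it.\<close>
  have "bij_betw f L (independent_sets (galois_graph L))"
    if "inj_on f L" "f ` L \<subseteq> independent_sets (galois_graph L)" for f
    using that card_subset_eq[OF fin that(2)] card card_image[OF that(1)]
    by (simp add: bij_betw_def)
  with maps inj_on_down_labels[OF cd assms(1)] inj_on_up_labels[OF cd assms(1)] show ?thesis by blast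
qed

end
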